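(* Let $0<\alpha<1$, $\lambda>0$, $a>0$, $y_a\in\mathbb{R}$, let $J\subseteq\mathbb{R}$ be an interval and let $f:[0,a]\times J\to\mathbb{R}$ be continuous and satisfy $|f(t,u)-f(t,v)|\le L|u-v|$ for all $t\in[0,a]$, $u,v\in J$, where $0<L<\dfrac{\Gamma(\alpha+1)}{2a^{\alpha}e^{\lambda a}}$. Let $y$ be the unique ($J$-valued) solution of $$\mathbb{D}^{\alpha,\lambda}(y(t))=f(t,y(t)),\ t\in[0,a],\quad e^{\lambda a}y(a)=y_a,$$ and, for $0<\delta\le\lambda$, let $z=z_\delta$ be the unique ($J$-valued) solution of $$\mathbb{D}^{\alpha,\lambda-\delta}(z(t))=f(t,z(t)),\ t\in[0,a],\quad e^{(\lambda-\delta)a}z(a)=y_a.$$ Then $\|y-z_\delta\|=\mathcal{O}(\delta)$ as $\delta\to0^+$; that is, there are constants $C>0$ and $\delta_0\in(0,\lambda]$ such that $\|y-z_\delta\|\le C\delta$ for all $\delta\in(0,\delta_0)$.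
   Context: $\|g\|=\max_{t\in[0,a]}|g(t)|$ for $g\in C([0,a])$. For $0<\alpha<1$ and $\nu\ge0$ the (left-sided) Caputo tempered fractional derivative is $$\mathbb{D}^{\alpha,\nu}(y(t))=\frac{e^{-\nu t}}{\Gamma(1-\alpha)}\int_0^t (t-s)^{-\alpha}\frac{d}{ds}\left(e^{\nu s}y(s)\right)ds.$$ Solutions are understood via the equivalent integral equation: a solution of $\mathbb{D}^{\alpha,\nu}(w(t))=f(t,w(t))$ on $[0,a]$ with $e^{\nu a}w(a)=y_a$ is a continuous function $w:[0,a]\to J$ such that for all $t\in[0,a]$ $$w(t)=y_a e^{-\nu t}-\frac{e^{-\nu t}}{\Gamma(\alpha)}\int_0^a e^{\nu s}(a-s)^{\alpha-1}f(s,w(s))\,ds+\frac{e^{-\nu t}}{\Gamma(\alpha)}\int_0^t e^{\nu s}(t-s)^{\alpha-1}f(s,w(s))\,ds.$$ The unique solutions $y$ and $z_\delta$ are assumed to exist (for all sufficiently small $\delta$ in the case of $z_\delta$). *)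

theory Defs
  imports "HOL-Analysis.Analysis"
begin

text \<open>
  For a function that is continuous on \<open>[0, a]\<close>, where \<open>a \<ge> 0\<close>, the supremum is attained, so this
  is the maximum norm.
\<close>

definition max_norm :: "real \<Rightarrow> (real \<Rightarrow> real) \<Rightarrow> real" where
  "max_norm a g = (SUP t\<in>{0..a}. \<bar>g t\<bar>)"

text \<open>
  A \<open>J\<close>-valued solution on \<open>[0, a]\<close> of the terminal value problem for the left-sided Caputo
  tempered fractional derivative of order \<open>\<alpha>\<close> with tempering parameter \<open>\<nu>\<close>, right-hand side \<open>f\<close>
  and terminal condition \<open>exp (\<nu> a) w(a) = y\<^sub>a\<close>, understood via the equivalent integral equation
  (which at \<open>t = a\<close> reduces to the terminal condition). The values of \<open>w\<close> outside \<open>[0, a]\<close> and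
  those of \<open>f\<close> outside \<open>[0, a] \<times> J\<close> play no role. At \<open>s = t\<close> the singular kernel takes the value
  \<open>0 powr (\<alpha> - 1) = 0\<close>, which does not affect the integral.
\<close>

definition tempered_tvp_solution ::
  "real \<Rightarrow> real \<Rightarrow> real \<Rightarrow> real \<Rightarrow> real set \<Rightarrow> (real \<Rightarrow> real \<Rightarrow> real) \<Rightarrow> (real \<Rightarrow> real) \<Rightarrow> bool" where
  "tempered_tvp_solution \<alpha> \<nu> a y\<^sub>a J f w \<longleftrightarrow>
     continuous_on {0..a} w \<and> w ` {0..a} \<subseteq> J \<and>
     (\<forall>t\<in>{0..a}. w t =
        y\<^sub>a * exp (- \<nu> * t)
        - exp (- \<nu> * t) / Gamma \<alpha>
            * integral {0..a} (\<lambda>s. exp (\<nu> * s) * (a - s) powr (\<alpha> - 1) * f s (w s))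
        + exp (- \<nu> * t) / Gamma \<alpha>
            * integral {0..t} (\<lambda>s. exp (\<nu> * s) * (t - s) powr (\<alpha> - 1) * f s (w s)))"

definition unique_tempered_tvp_solution ::
  "real \<Rightarrow> real \<Rightarrow> real \<Rightarrow> real \<Rightarrow> real set \<Rightarrow> (real \<Rightarrow> real \<Rightarrow> real) \<Rightarrow> (real \<Rightarrow> real) \<Rightarrow> bool" where
  "unique_tempered_tvp_solution \<alpha> \<nu> a y\<^sub>a J f w \<longleftrightarrow>
     tempered_tvp_solution \<alpha> \<nu> a y\<^sub>a J f w \<and>
     (\<forall>v. tempered_tvp_solution \<alpha> \<nu> a y\<^sub>a J f v \<longrightarrow> (\<forall>t\<in>{0..a}. v t = w t))"

end

theory Submission
  imports Defs
begin

text \<open>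
  After moving the factor \<open>exp (- \<nu> * t)\<close> under the integrals, the difference of two solutions is
  governed by two Abel integrals of
  \<open>exp (\<lambda> * (s - t)) * f s (y s) - exp (\<mu> * (s - t)) * f s (z s)\<close>, with \<open>\<mu> = \<lambda> - \<delta>\<close>.
  Changing the exponent costs \<open>O(\<delta>)\<close>, since \<open>f s (y s)\<close> is bounded, and changing the solution costs
  at most \<open>exp (\<lambda> * a) * L * \<parallel>y - z\<parallel>\<close>. The bound on \<open>L\<close> makes the resulting coefficient
  of \<open>\<parallel>y - z\<parallel>\<close> smaller than 1, so that this term is absorbed on the left.
\<close>

text \<open>With the larger exponential factored out, \<open>1 + x \<le> exp x\<close> bounds the
  remaining factor \<open>1 - exp (v - u)\<close> by \<open>u - v\<close>.\<close>

lemma abs_diff_exp_le: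
  fixes p q m :: real
  assumes "p \<le> m" "q \<le> m"
  shows "\<bar>exp p - exp q\<bar> \<le> \<bar>p - q\<bar> * exp m"
proof -
  have aux: "\<bar>exp u - exp v\<bar> \<le> \<bar>u - v\<bar> * exp m" if "v \<le> u" "u \<le> m" for u v :: real
  proof -
    have "exp u - exp v = exp u * (1 - exp (v - u))"
      by (simp add: algebra_simps flip: exp_add)
    also have "\<dots> \<le> exp u * (u - v)"
      using exp_ge_add_one_self[of "v - u"] by (intro mult_left_mono) (linarith, simp)
    also have "\<dots> \<le> exp m * (u - v)"
      using that by (intro mult_right_mono) auto
    finally show ?thesis using that by (simp add: mult.commute)
  qed
  show ?thesis
    using aux[of p q] aux[of q p] assms by (cases "q \<le> p") (auto simp: abs_minus_commute)
qed

lemma has_integral_abel_kernel: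
  fixes \<alpha> T :: real
  assumes "0 < \<alpha>" "0 \<le> T"
  shows "((\<lambda>s. (T - s) powr (\<alpha> - 1)) has_integral (T powr \<alpha> / \<alpha>)) {0..T}"
proof -
  have "((\<lambda>x. x powr (\<alpha> - 1)) has_integral (T powr \<alpha> / \<alpha>)) (cbox 0 T)"
    using has_integral_powr_from_0[of "\<alpha> - 1" T] assms by simp
  \<comment> \<open>The reflection \<open>s \<mapsto> T - s\<close> moves the singularity from
    \<open>0\<close> to \<open>T\<close>.\<close>
  from has_integral_affinity[OF this, of "-1" T]
  show ?thesis by (simp add: image_affinity_atLeastAtMost_diff)
qed

text \<open>For \<open>\<alpha> < 1\<close> the kernel is unbounded near \<open>s = T\<close>, so
  continuity of \<open>g\<close> alone does not suffice: the integrand is the product of an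
  absolutely integrable kernel and a bounded measurable function.\<close>

lemma abel_integrand_integrable:
  fixes g :: "real \<Rightarrow> real"
  assumes "0 < \<alpha>" "0 \<le> T" "continuous_on {0..T} g"
  shows "(\<lambda>s. (T - s) powr (\<alpha> - 1) * g s) integrable_on {0..T}"
proof -
  have "(\<lambda>s. (T - s) powr (\<alpha> - 1)) absolutely_integrable_on {0..T}"
    using has_integral_abel_kernel[OF assms(1,2)]
    by (intro nonnegative_absolutely_integrable_1) (auto simp: integrable_on_def)
  moreover have "g \<in> borel_measurable (lebesgue_on {0..T})"
    using assms(3) by (intro continuous_imp_measurable_on_sets_lebesgue) auto
  moreover have "bounded (g ` {0..T})"
    using assms(3) by (intro compact_imp_bounded compact_continuous_image) auto
  ultimately have "(\<lambda>s. g s * (T - s) powr (\<alpha> - 1)) absolutely_integrable_on {0..T}"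
    by (intro absolutely_integrable_bounded_measurable_product_real) auto
  then show ?thesis
    by (simp add: mult.commute set_lebesgue_integral_eq_integral(1))
qed

text \<open>The kernel is nonnegative with total mass \<open>T powr \<alpha> / \<alpha>\<close>, so
  a pointwise bound survives integration against it.\<close>

lemma abel_integral_diff_le:
  fixes g h :: "real \<Rightarrow> real"
  assumes "0 < \<alpha>" "0 \<le> T" "continuous_on {0..T} g" "continuous_on {0..T} h"
    and B: "\<And>s. s \<in> {0..T} \<Longrightarrow> \<bar>g s - h s\<bar> \<le> B"
  shows "\<bar>integral {0..T} (\<lambda>s. (T - s) powr (\<alpha> - 1) * g s)
           - integral {0..T} (\<lambda>s. (T - s) powr (\<alpha> - 1) * h s)\<bar> \<le> B * (T powr \<alpha> / \<alpha>)"
proof -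
  let ?k = "\<lambda>s. (T - s) powr (\<alpha> - 1)"
  note int = abel_integrand_integrable[OF assms(1,2)]
  have K: "((\<lambda>s. ?k s * B) has_integral T powr \<alpha> / \<alpha> * B) {0..T}"
    by (intro has_integral_mult_left has_integral_abel_kernel assms)
  have "integral {0..T} (\<lambda>s. ?k s * g s) - integral {0..T} (\<lambda>s. ?k s * h s)
      = integral {0..T} (\<lambda>s. ?k s * g s - ?k s * h s)"
    by (rule Henstock_Kurzweil_Integration.integral_diff[symmetric]) (intro int assms)+
  also have "\<bar>\<dots>\<bar> \<le> integral {0..T} (\<lambda>s. ?k s * B)"
    unfolding real_norm_def[symmetric]
  proof (rule integral_norm_bound_integral)
    show "(\<lambda>s. ?k s * g s - ?k s * h s) integrable_on {0..T}"
      by (intro integrable_diff int assms)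
    show "(\<lambda>s. ?k s * B) integrable_on {0..T}"
      using K by (rule has_integral_integrable)
    show "norm (?k s * g s - ?k s * h s) \<le> ?k s * B" if "s \<in> {0..T}" for s
      using mult_left_mono[OF B[OF that], of "?k s"]
      by (simp add: abs_mult flip: right_diff_distrib)
  qed
  also have "\<dots> = B * (T powr \<alpha> / \<alpha>)"
    using integral_unique[OF K] by (simp add: mult.commute)
  finally show ?thesis .
qed

text \<open>In this form the exponential depends only on \<open>s - t\<close>, which is at most
  \<open>a\<close> in absolute value, and the kernel stands apart as in
  \<open>abel_integral_diff_le\<close>.\<close>

lemma tempered_tvp_solution_eq:
  assumes "tempered_tvp_solution \<alpha> \<nu> a y\<^sub>a J f w" "t \<in> {0..a}"
  shows "w t = y\<^sub>a * exp (- \<nu> * t)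
    - integral {0..a} (\<lambda>s. (a - s) powr (\<alpha> - 1) * (exp (\<nu> * (s - t)) * f s (w s))) / Gamma \<alpha>
    + integral {0..t} (\<lambda>s. (t - s) powr (\<alpha> - 1) * (exp (\<nu> * (s - t)) * f s (w s))) / Gamma \<alpha>"
proof -
  have I: "integral {0..T} (\<lambda>s. (T - s) powr (\<alpha> - 1) * (exp (\<nu> * (s - t)) * f s (w s)))
    = exp (- \<nu> * t) * integral {0..T} (\<lambda>s. exp (\<nu> * s) * (T - s) powr (\<alpha> - 1) * f s (w s))" for T
    unfolding integral_mult_right[symmetric]
    by (intro integral_cong) (simp add: algebra_simps exp_diff exp_minus field_simps)
  show ?thesis
    using assms unfolding tempered_tvp_solution_def I by simp
qed

text \<open>Continuity on a compact interval supplies the boundedness above without which the real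
  \<open>SUP\<close> is not an upper bound.\<close>

lemma abs_le_max_norm:
  assumes "continuous_on {0..a} g" "t \<in> {0..a}"
  shows "\<bar>g t\<bar> \<le> max_norm a g"
proof -
  have "compact ((\<lambda>t. \<bar>g t\<bar>) ` {0..a})"
    using assms(1) by (intro compact_continuous_image continuous_intros) auto
  then show ?thesis
    unfolding max_norm_def
    by (intro cSUP_upper assms) (simp add: bounded_imp_bdd_above compact_imp_bounded)
qed

lemma continuous_on_superposition:
  fixes f :: "real \<Rightarrow> real \<Rightarrow> real"
  assumes "continuous_on ({0..a} \<times> J) (\<lambda>(t, u). f t u)"
    and "continuous_on {0..a} w" "w ` {0..a} \<subseteq> J"
  shows "continuous_on {0..a} (\<lambda>s. f s (w s))"
proof -
  have "continuous_on {0..a} (\<lambda>s. (\<lambda>(t, u). f t u) (s, w s))"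
    by (rule continuous_on_compose2[OF assms(1)]) (use assms in \<open>auto intro!: continuous_intros\<close>)
  then show ?thesis by simp
qed

text \<open>\<open>D\<close> stays on both sides, to be absorbed later. \<open>M\<close> bounds
  \<open>f\<close> along \<open>y\<close> only, so the factor of \<open>lam - \<mu>\<close> is
  independent of \<open>\<mu>\<close> and \<open>z\<close>. Each factor 2 counts the two Abel
  integrals.\<close>

lemma tempered_tvp_difference_estimate:
  fixes \<alpha> lam \<mu> a y\<^sub>a L M :: real
  assumes \<alpha>: "0 < \<alpha>" and \<mu>: "0 \<le> \<mu>" "\<mu> \<le> lam" and a: "0 < a" and L: "0 \<le> L"
    and cont: "continuous_on ({0..a} \<times> J) (\<lambda>(t, u). f t u)"
    and lip: "\<And>t u v. t \<in> {0..a} \<Longrightarrow> u \<in> J \<Longrightarrow> v \<in> J \<Longrightarrow> \<bar>f t u - f t v\<bar> \<le> L * \<bar>u - v\<bar>"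
    and y: "tempered_tvp_solution \<alpha> lam a y\<^sub>a J f y"
    and z: "tempered_tvp_solution \<alpha> \<mu> a y\<^sub>a J f z"
    and M: "\<And>s. s \<in> {0..a} \<Longrightarrow> \<bar>f s (y s)\<bar> \<le> M"
  defines "D \<equiv> max_norm a (\<lambda>t. y t - z t)"
    and "E \<equiv> exp (lam * a)" and "c \<equiv> a powr \<alpha> / Gamma (\<alpha> + 1)"
  shows "D \<le> (lam - \<mu>) * (a * E * (\<bar>y\<^sub>a\<bar> + 2 * c * M)) + 2 * c * E * L * D"
proof -
  have y_cont: "continuous_on {0..a} y" and y_J: "y ` {0..a} \<subseteq> J"
    and z_cont: "continuous_on {0..a} z" and z_J: "z ` {0..a} \<subseteq> J"
    using y z unfolding tempered_tvp_solution_def by auto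
  note fy = continuous_on_superposition[OF cont y_cont y_J]
  note fz = continuous_on_superposition[OF cont z_cont z_J]
  have D: "\<bar>y s - z s\<bar> \<le> D" if "s \<in> {0..a}" for s
    unfolding D_def by (rule abs_le_max_norm) (use that y_cont z_cont in \<open>auto intro: continuous_intros\<close>)
  \<comment> \<open>Needed for \<open>x = s - t\<close> in the integrands and for
    \<open>x = - t\<close> in the terminal term.\<close>
  have exp_diff: "\<bar>exp (lam * x) - exp (\<mu> * x)\<bar> \<le> (lam - \<mu>) * a * E" if "\<bar>x\<bar> \<le> a" for x
  proof -
    have "lam * x \<le> lam * a" "\<mu> * x \<le> lam * a"
      using that \<mu> a by (auto intro: mult_left_mono order_trans[OF mult_left_mono[of x a \<mu>]] mult_right_mono)
    then have "\<bar>exp (lam * x) - exp (\<mu> * x)\<bar> \<le> \<bar>lam * x - \<mu> * x\<bar> * E"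
      unfolding E_def by (rule abs_diff_exp_le)
    also have "\<bar>lam * x - \<mu> * x\<bar> = (lam - \<mu>) * \<bar>x\<bar>"
      using \<mu> by (simp add: abs_mult flip: left_diff_distrib)
    also have "(lam - \<mu>) * \<bar>x\<bar> * E \<le> (lam - \<mu>) * a * E"
      using that \<mu> by (intro mult_right_mono mult_left_mono) (auto simp: E_def)
    finally show ?thesis .
  qed
  \<comment> \<open>The first summand is the cost of changing the exponent, the second that of
    changing the solution.\<close>
  define B where "B = (lam - \<mu>) * a * E * M + E * (L * D)"
  have "0 \<le> D" using D[of 0] a by auto
  have "0 \<le> M" using M[of 0] a by auto
  have "0 \<le> B"
    unfolding B_def E_def using \<mu> a L \<open>0 \<le> D\<close> \<open>0 \<le> M\<close> by auto
  have pos: "0 < Gamma \<alpha>" using \<alpha> by simp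
  have integrand: "\<bar>exp (lam * (s - t)) * f s (y s) - exp (\<mu> * (s - t)) * f s (z s)\<bar> \<le> B"
    if "s \<in> {0..a}" "t \<in> {0..a}" for s t
  proof -
    \<comment> \<open>The mixed term \<open>exp (\<mu> * (s - t)) * f s (y s)\<close> is inserted,
      so that the difference of exponentials meets \<open>f\<close> along \<open>y\<close>, where
      \<open>M\<close> applies.\<close>
    have "exp (lam * (s - t)) * f s (y s) - exp (\<mu> * (s - t)) * f s (z s)
      = (exp (lam * (s - t)) - exp (\<mu> * (s - t))) * f s (y s)
        + exp (\<mu> * (s - t)) * (f s (y s) - f s (z s))"
      by (simp add: algebra_simps)
    also have "\<bar>\<dots>\<bar> \<le> \<bar>exp (lam * (s - t)) - exp (\<mu> * (s - t))\<bar> * \<bar>f s (y s)\<bar>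
        + exp (\<mu> * (s - t)) * \<bar>f s (y s) - f s (z s)\<bar>"
      by (rule order_trans[OF abs_triangle_ineq]) (simp add: abs_mult)
    also have "\<dots> \<le> B"
      unfolding B_def
    proof (intro add_mono mult_mono exp_diff M)
      have "\<mu> * (s - t) \<le> \<mu> * a" "\<mu> * a \<le> lam * a"
        using that \<mu> a by (auto intro: mult_left_mono mult_right_mono)
      then show "exp (\<mu> * (s - t)) \<le> E" unfolding E_def by simp
      have "\<bar>f s (y s) - f s (z s)\<bar> \<le> L * \<bar>y s - z s\<bar>"
        using that y_J z_J by (intro lip) auto
      also have "\<dots> \<le> L * D" using D that L by (intro mult_left_mono) auto
      finally show "\<bar>f s (y s) - f s (z s)\<bar> \<le> L * D" .
    qed (use that \<mu> a in \<open>auto simp: E_def\<close>)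
    finally show ?thesis .
  qed
  \<comment> \<open>The upper limit \<open>T\<close> is kept separate from \<open>t\<close> in the
    exponent, since both \<open>T = a\<close> and \<open>T = t\<close> occur.\<close>
  have abel: "\<bar>integral {0..T} (\<lambda>s. (T - s) powr (\<alpha> - 1) * (exp (lam * (s - t)) * f s (y s))) / Gamma \<alpha>
      - integral {0..T} (\<lambda>s. (T - s) powr (\<alpha> - 1) * (exp (\<mu> * (s - t)) * f s (z s))) / Gamma \<alpha>\<bar>
      \<le> B * c" if "T \<in> {0..a}" "t \<in> {0..a}" for T t
  proof -
    have sub: "{0..T} \<subseteq> {0..a}" using that by auto
    have "\<bar>integral {0..T} (\<lambda>s. (T - s) powr (\<alpha> - 1) * (exp (lam * (s - t)) * f s (y s)))
      - integral {0..T} (\<lambda>s. (T - s) powr (\<alpha> - 1) * (exp (\<mu> * (s - t)) * f s (z s)))\<bar>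
      \<le> B * (T powr \<alpha> / \<alpha>)"
      using that integrand sub
      by (intro abel_integral_diff_le \<alpha> continuous_intros continuous_on_subset[OF fy] continuous_on_subset[OF fz]) auto
    also have "\<dots> \<le> B * (a powr \<alpha> / \<alpha>)"
      using that \<alpha> \<open>0 \<le> B\<close> by (intro mult_left_mono divide_right_mono powr_mono2) auto
    \<comment> \<open>This is
      \<open>Gamma (\<alpha> + 1) = \<alpha> * Gamma \<alpha>\<close>.\<close>
    also have "\<dots> / Gamma \<alpha> = B * c"
      using Gamma_plus1[of \<alpha>] \<alpha> unfolding c_def by (simp add: nonpos_Ints_def)
    finally show ?thesis using pos by (simp add: divide_right_mono flip: diff_divide_distrib)
  qed
  have "\<bar>y t - z t\<bar> \<le> \<bar>y\<^sub>a\<bar> * ((lam - \<mu>) * a * E) + 2 * (B * c)" if t: "t \<in> {0..a}" for t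
  proof -
    have "\<bar>y\<^sub>a * exp (- lam * t) - y\<^sub>a * exp (- \<mu> * t)\<bar> \<le> \<bar>y\<^sub>a\<bar> * ((lam - \<mu>) * a * E)"
      using exp_diff[of "- t"] t
      by (auto simp: abs_mult simp flip: right_diff_distrib intro!: mult_left_mono)
    moreover have "a \<in> {0..a}" using a by simp
    note abel[OF this t] abel[OF t t]
    ultimately show ?thesis
      unfolding tempered_tvp_solution_eq[OF y t] tempered_tvp_solution_eq[OF z t]
      by linarith
  qed
  then have "D \<le> \<bar>y\<^sub>a\<bar> * ((lam - \<mu>) * a * E) + 2 * (B * c)"
    unfolding D_def max_norm_def using a by (intro cSUP_least) auto
  then show ?thesis unfolding B_def by (simp add: algebra_simps)
qed

theorem theorem6:
  fixes \<alpha> lam a y\<^sub>a L :: real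
    and J :: "real set"
    and f :: "real \<Rightarrow> real \<Rightarrow> real"
    and y :: "real \<Rightarrow> real"
    and z :: "real \<Rightarrow> real \<Rightarrow> real"
  assumes "0 < \<alpha>" and "\<alpha> < 1" and "0 < lam" and "0 < a"
    and "is_interval J"
    and "continuous_on ({0..a} \<times> J) (\<lambda>(t, u). f t u)"
    and "\<And>t u v. t \<in> {0..a} \<Longrightarrow> u \<in> J \<Longrightarrow> v \<in> J \<Longrightarrow> \<bar>f t u - f t v\<bar> \<le> L * \<bar>u - v\<bar>"
    and "0 < L" and "L < Gamma (\<alpha> + 1) / (2 * a powr \<alpha> * exp (lam * a))"
    and "unique_tempered_tvp_solution \<alpha> lam a y\<^sub>a J f y"
    and "\<forall>\<^sub>F \<delta> in at_right 0. unique_tempered_tvp_solution \<alpha> (lam - \<delta>) a y\<^sub>a J f (z \<delta>)"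
  shows "\<exists>C>0. \<exists>\<delta>\<^sub>0\<in>{0<..lam}. \<forall>\<delta>\<in>{0<..<\<delta>\<^sub>0}. max_norm a (\<lambda>t. y t - z \<delta> t) \<le> C * \<delta>"
proof -
  note y = assms(10)[unfolded unique_tempered_tvp_solution_def, THEN conjunct1]
  define E where "E = exp (lam * a)"
  define c where "c = a powr \<alpha> / Gamma (\<alpha> + 1)"
  define q where "q = 2 * c * E * L"
  have G: "0 < Gamma (\<alpha> + 1)" using assms(1) by simp
  have "L * (2 * a powr \<alpha> * exp (lam * a)) < Gamma (\<alpha> + 1)"
    using assms(4,9) by (simp add: pos_less_divide_eq)
  \<comment> \<open>\<open>q\<close> is the coefficient of the norm on the right of the estimate;
    the bound on \<open>L\<close> says exactly that it is below 1.\<close>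
  then have q: "q < 1"
    unfolding q_def c_def E_def using G by (simp add: field_simps)
  have "continuous_on {0..a} (\<lambda>s. f s (y s))"
    using y unfolding tempered_tvp_solution_def
    by (intro continuous_on_superposition[OF assms(6)]) auto
  then have M: "\<bar>f s (y s)\<bar> \<le> max_norm a (\<lambda>s. f s (y s))" if "s \<in> {0..a}" for s
    using that by (rule abs_le_max_norm)
  define M where "M = max_norm a (\<lambda>s. f s (y s))"
  have "0 \<le> M" using M[of 0] assms(4) unfolding M_def by auto
  define K where "K = a * E * (\<bar>y\<^sub>a\<bar> + 2 * c * M)"
  have "0 \<le> K"
    unfolding K_def E_def c_def using \<open>0 \<le> M\<close> assms(4) G by auto
  obtain b where "0 < b"
    and b: "\<And>\<delta>. 0 < \<delta> \<Longrightarrow> \<delta> < b \<Longrightarrow> unique_tempered_tvp_solution \<alpha> (lam - \<delta>) a y\<^sub>a J f (z \<delta>)"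
    using assms(11) unfolding eventually_at_right_field by auto
  \<comment> \<open>Below \<open>b\<close> the function \<open>z \<delta>\<close> is a solution, and
    below \<open>lam\<close> its tempering parameter is nonnegative. Adding 1 keeps the constant
    positive even if \<open>K = 0\<close>.\<close>
  have "max_norm a (\<lambda>t. y t - z \<delta> t) \<le> (K / (1 - q) + 1) * \<delta>" if "\<delta> \<in> {0<..<min b lam}" for \<delta>
  proof -
    have z: "tempered_tvp_solution \<alpha> (lam - \<delta>) a y\<^sub>a J f (z \<delta>)"
      using b that unfolding unique_tempered_tvp_solution_def by auto
    let ?D = "max_norm a (\<lambda>t. y t - z \<delta> t)"
    have "?D \<le> (lam - (lam - \<delta>)) * (a * exp (lam * a) * (\<bar>y\<^sub>a\<bar> + 2 * (a powr \<alpha> / Gamma (\<alpha> + 1)) * M))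
        + 2 * (a powr \<alpha> / Gamma (\<alpha> + 1)) * exp (lam * a) * L * ?D"
      using that assms(1,4,8) M
      by (intro tempered_tvp_difference_estimate[OF _ _ _ _ _ assms(6,7) y z]) (auto simp: M_def)
    \<comment> \<open>Absorption: the term \<open>q * ?D\<close> moves to the left.\<close>
    then have "(1 - q) * ?D \<le> K * \<delta>"
      unfolding K_def q_def c_def E_def by (simp add: algebra_simps)
    then have "?D \<le> K / (1 - q) * \<delta>"
      using q by (simp add: field_simps)
    then show ?thesis using that by (simp add: algebra_simps)
  qed
  moreover have "0 < K / (1 - q) + 1"
    using \<open>0 \<le> K\<close> q by (intro add_nonneg_pos) auto
  moreover have "min b lam \<in> {0<..lam}" using \<open>0 < b\<close> assms(3) by auto
  ultimately show ?thesis by blast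
qed

end
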